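(* For every instance of DDP-NS, the algorithm AlgoFor-DDP-NS (described in the context) returns a feasible solution, i.e. every delivery is assigned to exactly one drone and every drone's assignment is a pairwise compatible set of delivery intervals of total cost at most $B$, and the number of drones it uses is at most $$\frac{OPT_{NS}}{1-\epsilon_{max}} + \omega\Big(1-\frac{\epsilon_{min}}{1-\epsilon_{max}}\Big).$$
   Context: Instance of DDP-NS (drone delivery packing without battery stations): $n$ deliveries; delivery $j$ has a closed delivery time interval $I_j=[t_j^L,t_j^R]$ and a cost $cost(I_j)\in(0,B]$, where $B>0$ is the common battery capacity of identical drones. Two intervals are compatible if they are disjoint, otherwise they conflict. A feasible assignment of a drone is a set of pairwise compatible delivery intervals with total cost at most $B$. DDP-NS asks for the minimum number of drones such that each delivery is assigned to exactly one drone and each drone's assignment is feasible; $OPT_{NS}$ denotes this minimum. $\omega$ is the maximum number of pairwise conflicting delivery intervals. $\epsilon_{min}=\frac1B\min_{j}cost(I_j)$ and $\epsilon_{max}=\min\{\frac12,\frac1B\max_j cost(I_j)\}$. AlgoFor-DDP-NS: (1) build the interval graph $G$ whose vertices are the delivery intervals, two being adjacent iff they conflict; (2) properly color $G$ with $\omega$ colors, obtaining color classes $\mathcal J_1,\dots,\mathcal J_\omega$; (3) for each class $\mathcal J_k$ separately run the greedy procedure: process the intervals of $\mathcal J_k$ one by one in arbitrary order, keeping the drones used so far for $\mathcal J_k$ with their remaining capacities; assign $I_j$ to some already used drone for $\mathcal J_k$ whose remaining capacity is at least $cost(I_j)$ if one exists (decreasing that capacity by $cost(I_j)$), and otherwise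 use a new drone for $I_j$ with remaining capacity $B-cost(I_j)$; let $m_k$ be the number of drones used for $\mathcal J_k$; (4) output all $\sum_k m_k$ drones with their assignments. *)

theory Defs
  imports Complex_Main
begin

record ddp_instance =
  num_deliveries :: nat
  t_L :: "nat \<Rightarrow> real"
  t_R :: "nat \<Rightarrow> real"
  cost :: "nat \<Rightarrow> real"
  battery :: real

definition deliveries :: "ddp_instance \<Rightarrow> nat set" where
  "deliveries P = {1..num_deliveries P}"

definition ddp_ns :: "ddp_instance \<Rightarrow> bool" where
  "ddp_ns P \<longleftrightarrow> battery P > 0 \<and>
     (\<forall>j\<in>deliveries P. t_L P j \<le> t_R P j \<and> 0 < cost P j \<and> cost P j \<le> battery P)"

definition interval :: "ddp_instance \<Rightarrow> nat \<Rightarrow> real set" where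
  "interval P j = {t_L P j..t_R P j}"

definition compatible :: "ddp_instance \<Rightarrow> nat \<Rightarrow> nat \<Rightarrow> bool" where
  "compatible P i j \<longleftrightarrow> interval P i \<inter> interval P j = {}"

definition conflicting :: "ddp_instance \<Rightarrow> nat \<Rightarrow> nat \<Rightarrow> bool" where
  "conflicting P i j \<longleftrightarrow> \<not> compatible P i j"

text \<open>Deliveries are identified by their index, so distinct deliveries may have the same
  interval (and then conflict). The relation \<open>pairwise\<close> only constrains distinct elements.\<close>

definition feasible_assignment :: "ddp_instance \<Rightarrow> nat set \<Rightarrow> bool" where
  "feasible_assignment P S \<longleftrightarrow>
     S \<subseteq> deliveries P \<and> pairwise (compatible P) S \<and> (\<Sum>j\<in>S. cost P j) \<le> battery P"

text \<open>A solution is the list of the sets of deliveries assigned to the individual drones.\<close>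

definition feasible_solution :: "ddp_instance \<Rightarrow> nat set list \<Rightarrow> bool" where
  "feasible_solution P ds \<longleftrightarrow>
     (\<forall>j\<in>deliveries P. \<exists>!d. d < length ds \<and> j \<in> ds ! d) \<and>
     (\<forall>S\<in>set ds. feasible_assignment P S)"

definition OPT_NS :: "ddp_instance \<Rightarrow> nat" where
  "OPT_NS P = (LEAST m. \<exists>ds. feasible_solution P ds \<and> length ds = m)"

definition omega :: "ddp_instance \<Rightarrow> nat" where
  "omega P = Max {card S | S. S \<subseteq> deliveries P \<and> pairwise (conflicting P) S}"

definition eps_min :: "ddp_instance \<Rightarrow> real" where
  "eps_min P = 1 / battery P * Min (cost P ` deliveries P)"

definition eps_max :: "ddp_instance \<Rightarrow> real" where
  "eps_max P = min (1 / 2) (1 / battery P * Max (cost P ` deliveries P))"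

definition interval_graph_edges :: "ddp_instance \<Rightarrow> (nat \<times> nat) set" where
  "interval_graph_edges P =
     {(i, j). i \<in> deliveries P \<and> j \<in> deliveries P \<and> i \<noteq> j \<and> conflicting P i j}"

definition proper_coloring :: "'v set \<Rightarrow> ('v \<times> 'v) set \<Rightarrow> nat \<Rightarrow> ('v \<Rightarrow> nat) \<Rightarrow> bool" where
  "proper_coloring V E q c \<longleftrightarrow> c ` V \<subseteq> {1..q} \<and> (\<forall>(u, v)\<in>E. c u \<noteq> c v)"

definition color_class :: "ddp_instance \<Rightarrow> (nat \<Rightarrow> nat) \<Rightarrow> nat \<Rightarrow> nat set" where
  "color_class P c k = {j\<in>deliveries P. c j = k}"

text \<open>During the greedy procedure a drone is a pair of the set of deliveries assigned to it so far
  and its remaining capacity. The choice among several drones that can take the delivery is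
  left open, so the procedure is a relation between states.\<close>

inductive greedy_step ::
    "ddp_instance \<Rightarrow> nat \<Rightarrow> (nat set \<times> real) list \<Rightarrow> (nat set \<times> real) list \<Rightarrow> bool"
  for P :: ddp_instance and j :: nat where
  used_drone: "d < length ds \<Longrightarrow> ds ! d = (S, r) \<Longrightarrow> cost P j \<le> r \<Longrightarrow>
     greedy_step P j ds (ds[d := (insert j S, r - cost P j)])"
| new_drone: "\<forall>(S, r)\<in>set ds. r < cost P j \<Longrightarrow>
     greedy_step P j ds (ds @ [({j}, battery P - cost P j)])"

inductive greedy_run ::
    "ddp_instance \<Rightarrow> nat list \<Rightarrow> (nat set \<times> real) list \<Rightarrow> (nat set \<times> real) list \<Rightarrow> bool"
  for P :: ddp_instance where
  finished: "greedy_run P [] ds ds"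
| process: "greedy_step P j ds ds' \<Longrightarrow> greedy_run P js ds' ds'' \<Longrightarrow> greedy_run P (j # js) ds ds''"

definition greedy_result :: "ddp_instance \<Rightarrow> nat set \<Rightarrow> nat set list \<Rightarrow> bool" where
  "greedy_result P J ds \<longleftrightarrow>
     (\<exists>js ds'. distinct js \<and> set js = J \<and> greedy_run P js [] ds' \<and> ds = map fst ds')"

text \<open>\<open>algo_result P ds\<close>: the solution \<open>ds\<close> is a possible output on \<open>P\<close>, for some choice of the
  coloring, of the processing orders and of the drones receiving the deliveries.\<close>

definition algo_result :: "ddp_instance \<Rightarrow> nat set list \<Rightarrow> bool" where
  "algo_result P ds \<longleftrightarrow>
     (\<exists>c dss. proper_coloring (deliveries P) (interval_graph_edges P) (omega P) c \<and>
        (\<forall>k\<in>{1..omega P}. greedy_result P (color_class P c k) (dss k)) \<and>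
        ds = concat (map dss [1..<Suc (omega P)]))"

end

(* The greedy procedure opens a drone only when the new delivery fits on none of the old ones.
   Hence of two drones of a colour class the older one has remaining capacity below the cost of a
   delivery carried by the newer one, so all drones of the class but one carry at least
   (1 - eps_max) B, and the exceptional one carries at least eps_min B.  A maximum clique meets
   every colour class, so this gives m_k <= cost_k / ((1 - eps_max) B) + 1 - eps_min / (1 - eps_max)
   for each of the omega classes; summing over k and using that the total cost is at most
   OPT * B yields the bound.  Colouring intervals greedily by left endpoint needs only omega colours,
   since the earlier neighbours of an interval all contain its left endpoint. *)

theory Submission imports Defs begin

subsection \<open>Coverage of a point by a list of sets\<close>

text \<open>Counts list positions, so equal sets held by two drones count twice and the value 1
  means "exactly one drone". The sum form makes it additive under concatenation and suits double
  counting.\<close>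

definition cover :: "'a \<Rightarrow> 'a set list \<Rightarrow> nat" where
  "cover x Ss = (\<Sum>S\<leftarrow>Ss. of_bool (x \<in> S))"

lemma cover_eq_card: "cover x Ss = card {i. i < length Ss \<and> x \<in> Ss ! i}"
proof -
  have "cover x Ss = length (filter (\<lambda>S. x \<in> S) Ss)"
    by (induction Ss) (auto simp: cover_def)
  then show ?thesis
    by (simp add: length_filter_conv_card)
qed

lemma cover_eq_1_iff: "cover x Ss = 1 \<longleftrightarrow> (\<exists>!i. i < length Ss \<and> x \<in> Ss ! i)"
  unfolding cover_eq_card One_nat_def card_1_singleton_iff Ex1_def set_eq_iff mem_Collect_eq
    singleton_iff by blast

lemma cover_append: "cover x (Ss @ Ts) = cover x Ss + cover x Ts"
  by (simp add: cover_def)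

lemma cover_concat_map: "cover x (concat (map f ks)) = (\<Sum>k\<leftarrow>ks. cover x (f k))"
  by (induction ks) (auto simp: cover_append, simp add: cover_def)

lemma cover_update_insert:
  assumes "d < length Ss" "y \<notin> Ss ! d"
  shows "cover x (Ss[d := insert y (Ss ! d)]) = cover x Ss + of_bool (x = y)"
  using assms
proof (induction Ss arbitrary: d)
  case (Cons S Ss)
  then show ?case
    by (cases d) (auto simp: cover_def)
qed simp

text \<open>Double counting: \<open>x\<close> contributes \<open>f x\<close> once per entry
  containing it. Where \<open>cover\<close> is constantly 1, this turns the sum of drone loads into
  the total cost.\<close>

lemma sum_list_sum_eq_cover:
  fixes f :: "'a \<Rightarrow> real"
  assumes "finite A" "\<forall>S\<in>set Ss. S \<subseteq> A"
  shows "(\<Sum>S\<leftarrow>Ss. sum f S) = (\<Sum>x\<in>A. real (cover x Ss) * f x)"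
  using assms(2)
proof (induction Ss)
  case (Cons S Ss)
  have "sum f S = (\<Sum>x\<in>A. of_bool (x \<in> S) * f x)"
  proof -
    have "(\<Sum>x\<in>A. of_bool (x \<in> S) * f x) = (\<Sum>x\<in>A. if x \<in> S then f x else 0)"
      by (rule sum.cong) auto
    also have "\<dots> = sum f (A \<inter> S)"
      using assms(1) by (simp add: sum.inter_restrict)
    also have "A \<inter> S = S"
      using Cons.prems by auto
    finally show ?thesis by simp
  qed
  then show ?case
    using Cons by (simp add: cover_def sum.distrib distrib_right)
qed (simp add: cover_def)

text \<open>Serves the one drone of a colour class that may be lightly loaded and gets the weaker
  bound \<open>b\<close>.\<close>

lemma sum_list_ge_except_one:
  fixes xs :: "real list"
  assumes "p < length xs" "b \<le> xs ! p" "\<And>i. i < length xs \<Longrightarrow> i \<noteq> p \<Longrightarrow> a \<le> xs ! i"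
  shows "(real (length xs) - 1) * a + b \<le> sum_list xs"
proof -
  have "sum_list xs = xs ! p + (\<Sum>i\<in>{0..<length xs} - {p}. xs ! i)"
    using assms(1) by (simp add: sum_list_sum_nth sum.remove[of _ p])
  moreover have "of_nat (card ({0..<length xs} - {p})) * a \<le> (\<Sum>i\<in>{0..<length xs} - {p}. xs ! i)"
    using assms(3) by (intro sum_bounded_below) auto
  moreover have "real (card ({0..<length xs} - {p})) = real (length xs) - 1"
    using assms(1) by (simp add: of_nat_diff)
  ultimately show ?thesis
    using assms(2) by simp
qed

subsection \<open>Cliques and colourings\<close>

lemma finite_deliveries [simp]: "finite (deliveries P)"
  by (simp add: deliveries_def)

lemma finite_cliques:
  "finite {card S | S. S \<subseteq> deliveries P \<and> pairwise (conflicting P) S}"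
  by (rule finite_subset[of _ "card ` Pow (deliveries P)"]) auto

lemma card_clique_le_omega:
  assumes "S \<subseteq> deliveries P" "pairwise (conflicting P) S"
  shows "card S \<le> omega P"
  unfolding omega_def using assms by (intro Max_ge finite_cliques) auto

lemma clique_omega_exists:
  obtains S where "S \<subseteq> deliveries P" "pairwise (conflicting P) S" "card S = omega P"
proof -
  have "{card S | S. S \<subseteq> deliveries P \<and> pairwise (conflicting P) S} \<noteq> {}"
    by (auto intro!: exI[of _ "{}"])
  from Max_in[OF finite_cliques this] show thesis
    using that unfolding omega_def by auto
qed

text \<open>A maximum clique is coloured injectively and has as many members as there are colours,
  so it uses all of them. Nonemptiness matters because
  \<open>1 - eps_min P / (1 - eps_max P)\<close> can be negative, e.g. -1 when all costs equal the
  battery capacity; an empty class would then violate the per-class bound.\<close>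

lemma color_class_nonempty:
  assumes "proper_coloring (deliveries P) (interval_graph_edges P) (omega P) c"
    and "k \<in> {1..omega P}"
  shows "color_class P c k \<noteq> {}"
proof -
  obtain S where S: "S \<subseteq> deliveries P" "pairwise (conflicting P) S" "card S = omega P"
    by (rule clique_omega_exists)
  have "inj_on c S"
  proof (rule inj_onI, rule ccontr)
    fix x y assume "x \<in> S" "y \<in> S" "c x = c y" "x \<noteq> y"
    then have "(x, y) \<in> interval_graph_edges P"
      using S by (auto simp: interval_graph_edges_def pairwise_def)
    with assms(1) \<open>c x = c y\<close> show False
      by (auto simp: proper_coloring_def)
  qed
  then have "card (c ` S) = card {1..omega P}"
    using S by (simp add: card_image)
  moreover have "c ` S \<subseteq> {1..omega P}"
    using assms(1) S by (auto simp: proper_coloring_def)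
  ultimately have "c ` S = {1..omega P}"
    by (intro card_subset_eq) auto
  then obtain j where "j \<in> S" "c j = k"
    using assms(2) by (metis imageE)
  then show ?thesis
    using S by (auto simp: color_class_def)
qed

lemma proper_coloring_exists:
  assumes "ddp_ns P"
  obtains c where "proper_coloring (deliveries P) (interval_graph_edges P) (omega P) c"
proof -
  have "A \<subseteq> deliveries P \<longrightarrow> (\<exists>c. c ` A \<subseteq> {1..omega P} \<and>
      (\<forall>i\<in>A. \<forall>j\<in>A. i \<noteq> j \<longrightarrow> conflicting P i j \<longrightarrow> c i \<noteq> c j))" if "finite A" for A
    using that
  \<comment> \<open>Intervals are added by nondecreasing left endpoint. This induction rule allows
    \<open>x\<close> to lie in \<open>A\<close> already, hence the case split below.\<close>
  proof (induction A rule: finite_ranking_induct[where f = "t_L P"])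
    case (insert x A)
    show ?case
    proof
      assume sub: "insert x A \<subseteq> deliveries P"
      then obtain c where c: "c ` A \<subseteq> {1..omega P}"
          "\<And>i j. i \<in> A \<Longrightarrow> j \<in> A \<Longrightarrow> i \<noteq> j \<Longrightarrow> conflicting P i j \<Longrightarrow> c i \<noteq> c j"
        using insert.IH by auto
      show "\<exists>c. c ` insert x A \<subseteq> {1..omega P} \<and>
          (\<forall>i\<in>insert x A. \<forall>j\<in>insert x A. i \<noteq> j \<longrightarrow> conflicting P i j \<longrightarrow> c i \<noteq> c j)"
      proof (cases "x \<in> A")
        case True
        then show ?thesis
          unfolding insert_absorb[OF True] using c by blast
      next
        case False
        define N where "N = {i \<in> A. conflicting P i x}"
        \<comment> \<open>An interval that starts no later than \<open>x\<close> and meets it must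
          contain the left endpoint of \<open>x\<close>; this common point makes
          \<open>insert x N\<close> a clique.\<close>
        have mem: "t_L P x \<in> interval P i" if "i \<in> insert x N" for i
        proof (cases "i = x")
          case True
          then show ?thesis
            using sub assms by (auto simp: interval_def ddp_ns_def)
        next
          case False
          then have "i \<in> A" "conflicting P i x"
            using that by (auto simp: N_def)
          moreover from \<open>i \<in> A\<close> have "t_L P i \<le> t_L P x"
            using insert by auto
          ultimately show ?thesis
            unfolding conflicting_def compatible_def interval_def by auto
        qed
        have "pairwise (conflicting P) (insert x N)"
          using mem unfolding pairwise_def conflicting_def compatible_def by blast
        then have "card (insert x N) \<le> omega P"
          using sub by (intro card_clique_le_omega) (auto simp: N_def)
        moreover have "finite N" "x \<notin> N"
          using insert.hyps False by (auto simp: N_def)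
        moreover from \<open>finite N\<close> have "card (c ` N) \<le> card N"
          by (rule card_image_le)
        \<comment> \<open>\<open>x\<close> itself is one of the at most \<open>omega P\<close>
          clique members, so its neighbours in \<open>N\<close> leave a colour free.\<close>
        ultimately have "card (c ` N) < card {1..omega P}"
          by simp
        then have "\<not> {1..omega P} \<subseteq> c ` N"
          using \<open>finite N\<close> by (metis card_mono finite_imageI leD)
        then obtain q where q: "q \<in> {1..omega P}" "q \<notin> c ` N"
          by blast
        have symm: "conflicting P i j \<longleftrightarrow> conflicting P j i" for i j
          by (auto simp: conflicting_def compatible_def)
        have "(c(x := q)) ` insert x A \<subseteq> {1..omega P}"
          using c(1) q(1) by auto
        moreover have "(c(x := q)) i \<noteq> (c(x := q)) j"
          if ij: "i \<in> insert x A" "j \<in> insert x A" "i \<noteq> j" "conflicting P i j" for i j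
        proof (cases "i = x \<or> j = x")
          case True
          then obtain l where l: "l \<in> A" "l \<noteq> x" "conflicting P l x" "{i, j} = {x, l}"
            using ij symm[of i j] by blast
          then have "c l \<noteq> q"
            using q(2) by (auto simp: N_def)
          then show ?thesis
            using l True by (auto simp: doubleton_eq_iff)
        next
          case False
          then show ?thesis
            using that c(2)[of i j] by simp
        qed
        ultimately show ?thesis
          by blast
      qed
    qed
  qed simp
  from this[OF finite_deliveries[of P]] obtain c where
    "c ` deliveries P \<subseteq> {1..omega P}"
    "\<forall>i\<in>deliveries P. \<forall>j\<in>deliveries P. i \<noteq> j \<longrightarrow> conflicting P i j \<longrightarrow> c i \<noteq> c j"
    by blast
  then show thesis
    by (intro that[of c]) (auto simp: proper_coloring_def interval_graph_edges_def)
qed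

subsection \<open>The greedy procedure\<close>

lemma greedy_step_exists: "\<exists>ds'. greedy_step P j ds ds'"
proof (cases "\<forall>(S, r)\<in>set ds. r < cost P j")
  case True
  then show ?thesis
    using greedy_step.new_drone by blast
next
  case False
  then obtain S r where "(S, r) \<in> set ds" "cost P j \<le> r"
    by force
  then show ?thesis
    by (metis greedy_step.used_drone in_set_conv_nth)
qed

lemma greedy_run_exists: "\<exists>ds'. greedy_run P js ds ds'"
proof (induction js arbitrary: ds)
  case (Cons j js)
  then show ?case
    using greedy_step_exists by (metis greedy_run.process)
qed (auto intro: greedy_run.finished)

lemma greedy_result_exists:
  assumes "finite J"
  shows "\<exists>ds. greedy_result P J ds"
  using finite_distinct_list[OF assms] greedy_run_exists unfolding greedy_result_def by metis

text \<open>Here \<open>A\<close> is the set of deliveries processed so far and \<open>lo\<close>, \<open>hi\<close> bound the costs. The last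
  conjunct records why the \<open>i'\<close>-th drone was opened although the \<open>i\<close>-th was available.\<close>

definition greedy_inv ::
    "ddp_instance \<Rightarrow> real \<Rightarrow> real \<Rightarrow> nat set \<Rightarrow> (nat set \<times> real) list \<Rightarrow> bool" where
  "greedy_inv P lo hi A ds \<longleftrightarrow>
     (\<forall>(S, r)\<in>set ds. S \<subseteq> A \<and> sum (cost P) S = battery P - r \<and> 0 \<le> r \<and> lo \<le> battery P - r) \<and>
     (\<forall>j. cover j (map fst ds) = of_bool (j \<in> A)) \<and>
     (\<forall>i' < length ds. \<forall>i < i'. snd (ds ! i) < hi \<and> snd (ds ! i) + snd (ds ! i') < battery P)"

text \<open>Reusing a drone only lowers remaining capacities, so the comparisons between drones
  persist. A drone is opened when every older remaining capacity is below \<open>cost P j\<close>,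
  which is at most \<open>hi\<close> and equals the battery capacity minus what the new drone has
  left.\<close>

lemma greedy_step_inv:
  assumes "greedy_step P j ds ds'" "greedy_inv P lo hi A ds" "finite A" "j \<notin> A"
    and "0 < cost P j" "lo \<le> cost P j" "cost P j \<le> hi" "cost P j \<le> battery P"
  shows "greedy_inv P lo hi (insert j A) ds'"
proof -
  have loads: "\<And>S r. (S, r) \<in> set ds \<Longrightarrow>
        S \<subseteq> A \<and> sum (cost P) S = battery P - r \<and> 0 \<le> r \<and> lo \<le> battery P - r"
    and cov: "\<And>j. cover j (map fst ds) = of_bool (j \<in> A)"
    and rem: "\<And>i i'. i' < length ds \<Longrightarrow> i < i' \<Longrightarrow>
        snd (ds ! i) < hi \<and> snd (ds ! i) + snd (ds ! i') < battery P"
    using assms(2) by (auto simp: greedy_inv_def)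
  from assms(1) show ?thesis
  proof cases
    case (used_drone d S r)
    have Sr: "S \<subseteq> A" "sum (cost P) S = battery P - r" "lo \<le> battery P - r"
      using loads[of S r] used_drone by (metis nth_mem)+
    then have S: "j \<notin> S" "finite S"
      using assms by (auto intro: finite_subset)
    have "T \<subseteq> insert j A \<and> sum (cost P) T = battery P - q \<and> 0 \<le> q \<and> lo \<le> battery P - q"
      if "(T, q) \<in> set ds'" for T q
    proof -
      have "(T, q) = (insert j S, r - cost P j) \<or> (T, q) \<in> set ds"
        using that used_drone set_update_subset_insert by fastforce
      then show ?thesis
        using Sr S loads[of T q] used_drone assms by auto
    qed
    moreover have "cover i (map fst ds') = of_bool (i \<in> insert j A)" for i
      using cover_update_insert[of d "map fst ds" j i] used_drone S cov[of i] assms(4)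
      by (auto simp: map_update)
    moreover have "snd (ds' ! i) < hi \<and> snd (ds' ! i) + snd (ds' ! i') < battery P"
      if "i' < length ds'" "i < i'" for i i'
    proof -
      have "snd (ds' ! l) \<le> snd (ds ! l)" for l
        using used_drone assms(5) by (cases "l = d") auto
      from this[of i] this[of i'] show ?thesis
        using rem[of i' i] that used_drone by auto
    qed
    ultimately show ?thesis
      unfolding greedy_inv_def by blast
  next
    case new_drone
    have "T \<subseteq> insert j A \<and> sum (cost P) T = battery P - q \<and> 0 \<le> q \<and> lo \<le> battery P - q"
      if "(T, q) \<in> set ds'" for T q
      using that new_drone loads[of T q] assms by auto
    moreover have "cover i (map fst ds') = of_bool (i \<in> insert j A)" for i
      using new_drone cov[of i] assms(4) by (auto simp: cover_append) (simp_all add: cover_def)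
    moreover have "snd (ds' ! i) < hi \<and> snd (ds' ! i) + snd (ds' ! i') < battery P"
      if "i' < length ds'" "i < i'" for i i'
    proof (cases "i' < length ds")
      case True
      then show ?thesis
        using rem[of i' i] that new_drone by (auto simp: nth_append)
    next
      case False
      then have "i' = length ds" "i < length ds"
        using that new_drone by auto
      moreover from this have "snd (ds ! i) < cost P j"
        using new_drone nth_mem[of i ds] by (auto simp: case_prod_beta)
      ultimately show ?thesis
        using new_drone assms by (auto simp: nth_append)
    qed
    ultimately show ?thesis
      unfolding greedy_inv_def by blast
  qed
qed

lemma greedy_run_inv:
  assumes "greedy_run P js ds ds'" "greedy_inv P lo hi A ds" "finite A" "distinct js"
    and "set js \<inter> A = {}"
    and "\<And>j. j \<in> set js \<Longrightarrow> 0 < cost P j \<and> lo \<le> cost P j \<and> cost P j \<le> hi \<and> cost P j \<le> battery P"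
  shows "greedy_inv P lo hi (set js \<union> A) ds'"
  using assms
proof (induction arbitrary: A rule: greedy_run.induct)
  case (process j ds ds' js ds'')
  have "greedy_inv P lo hi (insert j A) ds'"
    using process by (intro greedy_step_inv[OF process.hyps(1)]) auto
  then have "greedy_inv P lo hi (set js \<union> insert j A) ds''"
    using process by (intro process.IH) auto
  then show ?case
    by simp
qed simp

text \<open>The bounds are the extreme costs over all deliveries rather than over \<open>J\<close>,
  so that every class yields the same constants, those in \<open>eps_min\<close> and
  \<open>eps_max\<close>.\<close>

lemma greedy_result_inv:
  assumes "greedy_result P J ds" "ddp_ns P" "J \<subseteq> deliveries P"
  obtains ds' where "ds = map fst ds'"
    "greedy_inv P (Min (cost P ` deliveries P)) (Max (cost P ` deliveries P)) J ds'"
proof -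
  obtain js ds' where js: "distinct js" "set js = J" "greedy_run P js [] ds'" "ds = map fst ds'"
    using assms(1) by (auto simp: greedy_result_def)
  have "greedy_inv P (Min (cost P ` deliveries P)) (Max (cost P ` deliveries P)) (set js \<union> {}) ds'"
    using js assms by (intro greedy_run_inv[OF js(3)])
      (auto simp: greedy_inv_def cover_def ddp_ns_def subset_iff)
  then show thesis
    using that js by auto
qed

text \<open>In the application \<open>a\<close> is \<open>(1 - eps_max P) * battery P\<close>. All
  loads but one reach \<open>a\<close>, the remaining one reaches \<open>lo\<close>, and the loads
  add up to the total cost because each delivery of \<open>A\<close> is covered once.\<close>

lemma greedy_inv_load_bound:
  assumes "greedy_inv P lo hi A ds" "ds \<noteq> []" "finite A"
    and "battery P - a = min (battery P / 2) hi"
  shows "(real (length ds) - 1) * a + lo \<le> sum (cost P) A"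
proof -
  define load where "load = map (\<lambda>(S, r). battery P - r) ds"
  have len: "length load = length ds"
    by (simp add: load_def)
  have nth: "load ! i = battery P - snd (ds ! i)" if "i < length ds" for i
    using that by (simp add: load_def case_prod_beta)
  have lo: "lo \<le> load ! i" if "i < length ds" for i
    using assms(1) that nth_mem[OF that] by (auto simp: nth greedy_inv_def case_prod_beta)
  have rem: "snd (ds ! i) < hi" "snd (ds ! i) + snd (ds ! i') < battery P"
    if "i < i'" "i' < length ds" for i i'
    using assms(1) that by (auto simp: greedy_inv_def)
  have "\<exists>p<length ds. \<forall>i<length ds. i \<noteq> p \<longrightarrow> a \<le> load ! i"
  proof (cases "hi \<le> battery P / 2")
    \<comment> \<open>Now \<open>a = battery P - hi\<close>. Every drone before the last has less
      than \<open>hi\<close> left, so the last one is the exception.\<close>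
    case True
    have "a \<le> load ! i" if "i < length ds" "i \<noteq> length ds - 1" for i
    proof -
      have "snd (ds ! i) < hi"
        using that by (intro rem(1)[of i "length ds - 1"]) auto
      then show ?thesis
        using that assms(4) True by (simp add: nth)
    qed
    then show ?thesis
      using assms(2) by (intro exI[of _ "length ds - 1"]) auto
  next
    case False
    then have a: "a = battery P / 2"
      using assms(4) by simp
    show ?thesis
    proof (cases "\<exists>p<length ds. load ! p < a")
      case True
      then obtain p where p: "p < length ds" "load ! p < a"
        by blast
      \<comment> \<open>Two remaining capacities sum to less than the battery capacity, so two loads
        sum to more than it: one load below half forces every other above half.\<close>
      have "a \<le> load ! i" if "i < length ds" "i \<noteq> p" for i
      proof -
        have "snd (ds ! i) + snd (ds ! p) < battery P"
          using rem(2)[of i p] rem(2)[of p i] that p(1) by (cases "i < p") auto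
        then show ?thesis
          using p that a by (simp add: nth)
      qed
      then show ?thesis
        using p(1) by blast
    next
      \<comment> \<open>With no load below \<open>a\<close> any index serves as \<open>p\<close>;
        one exists since \<open>ds\<close> is nonempty.\<close>
      case False
      then show ?thesis
        using assms(2) by (metis length_greater_0_conv not_less)
    qed
  qed
  then obtain p where "p < length ds" "\<And>i. i < length ds \<Longrightarrow> i \<noteq> p \<Longrightarrow> a \<le> load ! i"
    by blast
  then have "(real (length load) - 1) * a + lo \<le> sum_list load"
    using lo len by (intro sum_list_ge_except_one) auto
  also have "load = map (sum (cost P)) (map fst ds)"
    using assms(1) by (auto simp: load_def greedy_inv_def)
  also have "sum_list \<dots> = (\<Sum>x\<in>A. real (cover x (map fst ds)) * cost P x)"
    using assms(1,3) by (intro sum_list_sum_eq_cover) (fastforce simp: greedy_inv_def)+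
  also have "\<dots> = sum (cost P) A"
    using assms(1) by (intro sum.cong) (auto simp: greedy_inv_def)
  finally show ?thesis
    using len by simp
qed

subsection \<open>The algorithm\<close>

text \<open>Keeps the guarantee about all outputs from being vacuous: a colouring with
  \<open>omega P\<close> colours exists, and the two greedy rules together never get stuck.\<close>

lemma algo_result_exists:
  assumes "ddp_ns P"
  shows "\<exists>ds. algo_result P ds"
proof -
  obtain c where c: "proper_coloring (deliveries P) (interval_graph_edges P) (omega P) c"
    using proper_coloring_exists[OF assms] .
  have "\<forall>k. \<exists>ds. greedy_result P (color_class P c k) ds"
    by (intro allI greedy_result_exists) (simp add: color_class_def)
  then obtain dss where "\<forall>k. greedy_result P (color_class P c k) (dss k)"
    by metis
  with c show ?thesis
    unfolding algo_result_def by blast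
qed

lemma algo_result_feasible:
  assumes "ddp_ns P" "algo_result P ds"
  shows "feasible_solution P ds"
proof -
  obtain c dss where c: "proper_coloring (deliveries P) (interval_graph_edges P) (omega P) c"
    and dss: "\<forall>k\<in>{1..omega P}. greedy_result P (color_class P c k) (dss k)"
    and ds: "ds = concat (map dss [1..<Suc (omega P)])"
    using assms(2) unfolding algo_result_def by metis
  have cc: "color_class P c k \<subseteq> deliveries P" for k
    by (auto simp: color_class_def)
  have cov: "cover j (dss k) = of_bool (j \<in> color_class P c k)" if "k \<in> {1..omega P}" for j k
    by (rule greedy_result_inv[OF bspec[OF dss that] assms(1) cc]) (auto simp: greedy_inv_def)
  have "\<exists>!d. d < length ds \<and> j \<in> ds ! d" if j: "j \<in> deliveries P" for j
  proof -
    have "cover j ds = (\<Sum>k\<in>{1..omega P}. cover j (dss k))"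
      unfolding ds cover_concat_map by (simp add: sum_list_distinct_conv_sum_set atLeastLessThanSuc_atLeastAtMost del: upt_Suc)
    \<comment> \<open>Only the class of colour \<open>c j\<close> covers \<open>j\<close>, and it
      does so once; the sum is 1 because \<open>c j\<close> lies in
      \<open>{1..omega P}\<close>.\<close>
    also have "\<dots> = (\<Sum>k\<in>{1..omega P}. if k = c j then 1 else 0)"
      using j by (intro sum.cong) (auto simp: cov color_class_def)
    also have "\<dots> = 1"
      using c j by (auto simp: proper_coloring_def image_subset_iff)
    finally show ?thesis
      by (simp only: cover_eq_1_iff)
  qed
  moreover have "feasible_assignment P S" if S: "S \<in> set ds" for S
  proof -
    obtain k where k: "k \<in> {1..omega P}" "S \<in> set (dss k)"
      using S unfolding ds set_concat set_map set_upt atLeastLessThanSuc_atLeastAtMost by blast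
    obtain ds' where ds': "dss k = map fst ds'"
      "greedy_inv P (Min (cost P ` deliveries P)) (Max (cost P ` deliveries P)) (color_class P c k) ds'"
      by (rule greedy_result_inv[OF bspec[OF dss k(1)] assms(1) cc])
    then have "S \<subseteq> color_class P c k" "sum (cost P) S \<le> battery P"
      using k(2) by (fastforce simp: greedy_inv_def)+
    moreover have "compatible P i j" if "i \<in> color_class P c k" "j \<in> color_class P c k" "i \<noteq> j" for i j
    proof (rule ccontr)
      assume "\<not> compatible P i j"
      then have "(i, j) \<in> interval_graph_edges P"
        using that by (simp add: color_class_def interval_graph_edges_def conflicting_def)
      then have "c i \<noteq> c j"
        using c unfolding proper_coloring_def by blast
      then show False
        using that by (simp add: color_class_def)
    qed
    ultimately show ?thesis
      using cc[of k] unfolding feasible_assignment_def pairwise_def by blast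
  qed
  ultimately show ?thesis
    by (auto simp: feasible_solution_def)
qed

text \<open>A volume bound: each drone of an optimal solution carries at most a full battery. The
  assumed feasible solution guarantees that the \<open>LEAST\<close> in \<open>OPT_NS\<close> is
  attained.\<close>

lemma total_cost_le_OPT:
  assumes "feasible_solution P ds"
  shows "sum (cost P) (deliveries P) \<le> real (OPT_NS P) * battery P"
proof -
  have "\<exists>es. feasible_solution P es \<and> length es = OPT_NS P"
    unfolding OPT_NS_def by (rule LeastI[of _ "length ds"]) (use assms in blast)
  then obtain es where es: "feasible_solution P es" "length es = OPT_NS P"
    by blast
  have "sum (cost P) (deliveries P) = (\<Sum>x\<in>deliveries P. real (cover x es) * cost P x)"
    using es(1) by (intro sum.cong) (auto simp: feasible_solution_def cover_eq_1_iff[THEN iffD2])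
  also have "\<dots> = (\<Sum>S\<leftarrow>es. sum (cost P) S)"
    using es(1) by (intro sum_list_sum_eq_cover[symmetric])
      (auto simp: feasible_solution_def feasible_assignment_def)
  also have "\<dots> \<le> (\<Sum>S\<leftarrow>es. battery P)"
    using es(1) by (intro sum_list_mono) (auto simp: feasible_solution_def feasible_assignment_def)
  finally show ?thesis
    using es(2) by (simp add: sum_list_triv)
qed

section \<open>Bound on the number of drones\<close>

lemma eps_max_less_1: "eps_max P < 1"
proof -
  \<comment> \<open>The cap 1/2 gives this even without deliveries, when \<open>Max\<close> is taken
    over the empty set.\<close>
  have "eps_max P \<le> 1 / 2"
    unfolding eps_max_def by (rule min.cobounded1)
  then show ?thesis
    by simp
qed

lemma greedy_result_length_bound:
  assumes "ddp_ns P" "greedy_result P J ds" "J \<subseteq> deliveries P" "J \<noteq> {}"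
  shows "real (length ds) \<le> sum (cost P) J / battery P / (1 - eps_max P)
    + (1 - eps_min P / (1 - eps_max P))"
proof -
  define B where "B = battery P"
  define e where "e = 1 - eps_max P"
  have B: "B > 0"
    using assms(1) by (simp add: B_def ddp_ns_def)
  have e: "e > 0"
    using eps_max_less_1[of P] by (simp add: e_def)
  obtain ds' where ds': "ds = map fst ds'"
    "greedy_inv P (Min (cost P ` deliveries P)) (Max (cost P ` deliveries P)) J ds'"
    by (rule greedy_result_inv[OF assms(2,1,3)])
  \<comment> \<open>A delivery in \<open>J\<close> has coverage 1, while the empty list covers
    nothing.\<close>
  have "ds' \<noteq> []"
    using ds' assms(4) by (auto simp: greedy_inv_def cover_def)
  \<comment> \<open>\<open>B * e\<close> is the \<open>a\<close> of the load bound: scaling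
    \<open>eps_max P\<close> by \<open>B\<close> gives the smaller of half the battery capacity and
    the maximum cost.\<close>
  moreover have "battery P - B * e = min (battery P / 2) (Max (cost P ` deliveries P))"
  proof -
    have "B * eps_max P = min (B * (1 / 2)) (B * (1 / B * Max (cost P ` deliveries P)))"
      using B by (simp add: eps_max_def B_def min_mult_distrib_left)
    then show ?thesis
      using B by (simp add: e_def B_def algebra_simps)
  qed
  ultimately have "(real (length ds) - 1) * (B * e) + Min (cost P ` deliveries P) \<le> sum (cost P) J"
    using greedy_inv_load_bound[OF ds'(2)] ds'(1) finite_subset[OF assms(3)] by simp
  moreover have "Min (cost P ` deliveries P) = B * eps_min P"
    using B by (simp add: eps_min_def B_def)
  ultimately have "real (length ds) * (B * e) \<le> sum (cost P) J + B * e - B * eps_min P"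
    by (simp add: left_diff_distrib)
  then have "real (length ds) \<le> (sum (cost P) J + B * e - B * eps_min P) / (B * e)"
    using B e by (simp only: pos_le_divide_eq mult_pos_pos)
  also have "\<dots> = sum (cost P) J / B / e + (1 - eps_min P / e)"
    using B e by (simp add: add_divide_distrib diff_divide_distrib)
  finally have "real (length ds) \<le> sum (cost P) J / B / e + (1 - eps_min P / e)" .
  then show ?thesis
    by (simp add: B_def e_def)
qed

theorem theorem1:
  fixes P :: ddp_instance
  assumes "ddp_ns P"
  shows "(\<exists>ds. algo_result P ds) \<and>
    (\<forall>ds. algo_result P ds \<longrightarrow>
       feasible_solution P ds \<and>
       real (length ds) \<le> real (OPT_NS P) / (1 - eps_max P)
         + real (omega P) * (1 - eps_min P / (1 - eps_max P)))"
proof (intro conjI allI impI)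
  show "\<exists>ds. algo_result P ds"
    by (rule algo_result_exists[OF assms])
next
  fix ds assume ds: "algo_result P ds"
  show feas: "feasible_solution P ds"
    by (rule algo_result_feasible[OF assms ds])
  define g where "g = 1 - eps_min P / (1 - eps_max P)"
  obtain c dss where c: "proper_coloring (deliveries P) (interval_graph_edges P) (omega P) c"
    and dss: "\<forall>k\<in>{1..omega P}. greedy_result P (color_class P c k) (dss k)"
    and ds_eq: "ds = concat (map dss [1..<Suc (omega P)])"
    using ds unfolding algo_result_def by metis
  have "length ds = (\<Sum>k\<in>{1..omega P}. length (dss k))"
    unfolding ds_eq
    by (simp add: length_concat comp_def sum_list_distinct_conv_sum_set
        atLeastLessThanSuc_atLeastAtMost del: upt_Suc)
  then have "real (length ds) = (\<Sum>k\<in>{1..omega P}. real (length (dss k)))"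
    by simp
  \<comment> \<open>No class is empty, so the per-class bound applies to every colour; without
    deliveries \<open>omega P\<close> is 0 and both sums are empty.\<close>
  also have "\<dots> \<le> (\<Sum>k\<in>{1..omega P}.
      sum (cost P) (color_class P c k) / battery P / (1 - eps_max P) + g)"
    unfolding g_def using c dss assms
    by (intro sum_mono greedy_result_length_bound color_class_nonempty)
      (auto simp: color_class_def)
  also have "\<dots> = (\<Sum>k\<in>{1..omega P}. sum (cost P) (color_class P c k)) / battery P / (1 - eps_max P)
      + real (omega P) * g"
    by (simp add: sum.distrib sum_divide_distrib)
  also have "(\<Sum>k\<in>{1..omega P}. sum (cost P) (color_class P c k)) = sum (cost P) (deliveries P)"
    unfolding color_class_def using c by (intro sum.group) (auto simp: proper_coloring_def)
  \<comment> \<open>The output \<open>ds\<close> itself is the feasible solution required for the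
    comparison with \<open>OPT_NS P\<close>.\<close>
  also have "sum (cost P) (deliveries P) / battery P / (1 - eps_max P)
      \<le> real (OPT_NS P) / (1 - eps_max P)"
    using total_cost_le_OPT[OF feas] assms eps_max_less_1[of P]
    by (intro divide_right_mono) (simp_all add: ddp_ns_def pos_divide_le_eq)
  finally show "real (length ds) \<le> real (OPT_NS P) / (1 - eps_max P)
      + real (omega P) * (1 - eps_min P / (1 - eps_max P))"
    by (simp add: g_def)
qed

end
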